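(* The classes $\mathcal{U}_H^0$ and $\mathcal{V}_H^0$ are each closed under harmonic convolution. Moreover: (i) $f_1*f_2\in\mathcal{SK}_H^0$ for all $f_1,f_2\in\mathcal{U}_H^0$; (ii) if $\varphi\in\mathcal{K}$ and $f\in\mathcal{U}_H^0$, then $\varphi\,\tilde{*}\,f\in\mathcal{U}_H^0$; (iii) if $\varphi\in\mathcal{K}$ and $f\in\mathcal{V}_H^0$, then $\varphi\,\tilde{*}\,f\in\mathcal{V}_H^0$.
   Context: $\mathbb{D}$ is the open unit disk. $\mathcal{H}$ is the class of harmonic $f=h+\bar g$ in $\mathbb{D}$ with $f(0)=0$, $f_z(0)=1$, $f_{\bar z}(0)=0$. $\mathcal{U}_H^0$ (resp. $\mathcal{V}_H^0$) is the set of $f(z)=z+\sum_{n\ge2}a_nz^n+\overline{\sum_{n\ge2}b_nz^n}\in\mathcal{H}$ with $\sum_{n\ge2}n(|a_n|+|b_n|)\le1$ (resp. $\sum_{n\ge2}n^2(|a_n|+|b_n|)\le1$). $\mathcal{K}$ is the class of analytic univalent $\varphi$ in $\mathbb{D}$ with $\varphi(0)=0,\varphi'(0)=1$ mapping $\mathbb{D}$ onto a convex domain. $\mathcal{SK}_H^0$ is the class of sense-preserving ($|g'|<|h'|$) univalent $f=h+\bar g\in\mathcal{H}$ such that $h+\lambda\bar g$ maps $\mathbb{D}$ univalently onto a convex domain for every $|\lambda|=1$. For analytic $f=\sum a_nz^n$, $F=\sum A_nz^n$, $f*F=\sum a_nA_nz^n$; harmonic convolution: $(h_1+\bar g_1)*(h_2+\bar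 g_2)=h_1*h_2+\overline{g_1*g_2}$; for analytic $\varphi$, $\varphi\,\tilde{*}\,(h+\bar g)=h*\varphi+\overline{g*\varphi}$. *)

theory Defs
  imports "HOL-Complex_Analysis.Complex_Analysis"
begin

text \<open>A harmonic map f = h + conj g on the unit disk is represented by the pair (h, g)
  of its analytic and co-analytic parts.\<close>
type_synonym harm = "(complex \<Rightarrow> complex) \<times> (complex \<Rightarrow> complex)"

abbreviation disk :: "complex set" where "disk \<equiv> ball 0 1"

definition tcoeff :: "(complex \<Rightarrow> complex) \<Rightarrow> nat \<Rightarrow> complex" where
  "tcoeff h n = (deriv ^^ n) h 0 / of_nat (fact n)"

definition aconv :: "(complex \<Rightarrow> complex) \<Rightarrow> (complex \<Rightarrow> complex) \<Rightarrow> complex \<Rightarrow> complex" where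
  "aconv f F = (\<lambda>z. \<Sum>n. tcoeff f n * tcoeff F n * z ^ n)"

definition hfun :: "harm \<Rightarrow> complex \<Rightarrow> complex" where
  "hfun f = (\<lambda>z. fst f z + cnj (snd f z))"

definition hconv :: "harm \<Rightarrow> harm \<Rightarrow> harm" where
  "hconv f1 f2 = (aconv (fst f1) (fst f2), aconv (snd f1) (snd f2))"

definition tconv :: "(complex \<Rightarrow> complex) \<Rightarrow> harm \<Rightarrow> harm" where
  "tconv \<phi> f = (aconv (fst f) \<phi>, aconv (snd f) \<phi>)"

definition classH :: "harm set" where
  "classH = {(h, g). h holomorphic_on disk \<and> g holomorphic_on disk \<and>
     h 0 = 0 \<and> g 0 = 0 \<and> deriv h 0 = 1 \<and> deriv g 0 = 0}"

definition classU :: "harm set" where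
  "classU = {(h, g). (h, g) \<in> classH \<and>
     summable (\<lambda>n. real (n + 2) * (norm (tcoeff h (n + 2)) + norm (tcoeff g (n + 2)))) \<and>
     (\<Sum>n. real (n + 2) * (norm (tcoeff h (n + 2)) + norm (tcoeff g (n + 2)))) \<le> 1}"

definition classV :: "harm set" where
  "classV = {(h, g). (h, g) \<in> classH \<and>
     summable (\<lambda>n. real (n + 2) ^ 2 * (norm (tcoeff h (n + 2)) + norm (tcoeff g (n + 2)))) \<and>
     (\<Sum>n. real (n + 2) ^ 2 * (norm (tcoeff h (n + 2)) + norm (tcoeff g (n + 2)))) \<le> 1}"

definition classK :: "(complex \<Rightarrow> complex) set" where
  "classK = {\<phi>. \<phi> holomorphic_on disk \<and> \<phi> 0 = 0 \<and> deriv \<phi> 0 = 1 \<and>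
     inj_on \<phi> disk \<and> convex (\<phi> ` disk)}"

definition classSK :: "harm set" where
  "classSK = {(h, g). (h, g) \<in> classH \<and>
     (\<forall>z\<in>disk. norm (deriv g z) < norm (deriv h z)) \<and>
     inj_on (hfun (h, g)) disk \<and>
     (\<forall>c::complex. norm c = 1 \<longrightarrow>
        inj_on (\<lambda>z. h z + c * cnj (g z)) disk \<and>
        convex ((\<lambda>z. h z + c * cnj (g z)) ` disk))}"

end

theory Submission
  imports Defs
begin

text \<open>
  A member of $\mathcal{U}_H^0$ has $n|a_n| \le 1$ and $n|b_n| \le 1$, so a convolution of two
  members lies in $\mathcal{V}_H^0$. Members of $\mathcal{V}_H^0$ are perturbations
  $F = \mathrm{id} + p$ of the identity, where $p$ is Lipschitz with constant $C$ and has second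
  differences controlled by $L$, with $C + L \le \sum n^2(|a_n|+|b_n|) \le 1$. To hit the point
  $t F(x) + (1-t) F(y)$, solve $u = t F(x) + (1-t) F(y) - p(u)$ by Banach's fixed point theorem in
  the ball of radius $s/2$, $s = t(1-t)|x-y|^2$, around $tx + (1-t)y$; that ball stays in the unit
  disk by the strong convexity of the disk, and is mapped to itself because $C + L \le 1$.

  For (ii) and (iii) it suffices that the Taylor coefficients of $\varphi \in \mathcal{K}$ are
  bounded by 1. Averaging $\varphi$ over the $n$-th roots of unity gives a function $\psi(z^n)$ with
  $\psi'(0) = c_n$ and $\psi(\mathbf{D}) \subseteq \varphi(\mathbf{D})$, and the Schwarz lemma
  applies to $\varphi^{-1} \circ \psi$.
\<close>

section \<open>Small perturbations of the identity on the unit ball\<close>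

lemma norm_convex_combination_squared:
  fixes x y :: "'a::real_inner"
  shows "(norm (t *\<^sub>R x + (1 - t) *\<^sub>R y))\<^sup>2 =
    t * (norm x)\<^sup>2 + (1 - t) * (norm y)\<^sup>2 - t * (1 - t) * (norm (x - y))\<^sup>2"
  by (simp add: power2_norm_eq_inner inner_simps inner_commute[of y x]) algebra

lemma inj_on_id_plus_contraction:
  fixes p :: "'a::real_normed_vector \<Rightarrow> 'a"
  assumes lip: "\<And>x y. x \<in> S \<Longrightarrow> y \<in> S \<Longrightarrow> norm (p x - p y) \<le> C * norm (x - y)" and "C < 1"
  shows "inj_on (\<lambda>z. z + p z) S"
proof (rule inj_onI, rule ccontr)
  fix x y assume *: "x \<in> S" "y \<in> S" "x + p x = y + p y" "x \<noteq> y"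
  then have "x - y = - (p x - p y)" by (simp add: algebra_simps)
  then have "norm (x - y) = norm (p x - p y)" by (metis norm_minus_cancel)
  also have "\<dots> \<le> C * norm (x - y)" using lip * by blast
  also have "\<dots> < 1 * norm (x - y)" using * \<open>C < 1\<close> by (intro mult_strict_right_mono) auto
  finally show False by simp
qed

text \<open>The constant \<open>C\<close> bounds the variation of \<open>p\<close>, and
  \<open>L\<close> bounds its failure to be affine on a segment. Both errors are measured against
  the same radius s/2, which is why only the sum \<open>C + L\<close> has to be at most 1.\<close>

lemma convex_image_id_plus_contraction:
  fixes p :: "'a::{real_inner, banach} \<Rightarrow> 'a"
  assumes lip: "\<And>x y. x \<in> ball 0 1 \<Longrightarrow> y \<in> ball 0 1 \<Longrightarrow> norm (p x - p y) \<le> C * norm (x - y)"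
    and sec: "\<And>x y t. x \<in> ball 0 1 \<Longrightarrow> y \<in> ball 0 1 \<Longrightarrow> 0 \<le> t \<Longrightarrow> t \<le> 1 \<Longrightarrow>
      norm (t *\<^sub>R p x + (1 - t) *\<^sub>R p y - p (t *\<^sub>R x + (1 - t) *\<^sub>R y)) \<le>
        L / 2 * (t * (1 - t) * (norm (x - y))\<^sup>2)"
    and C: "0 \<le> C" "C < 1" "C + L \<le> 1"
  shows "convex ((\<lambda>z. z + p z) ` ball 0 1)"
proof (rule convexI)
  fix u v :: 'a and t t' :: real
  assume "u \<in> (\<lambda>z. z + p z) ` ball 0 1" "v \<in> (\<lambda>z. z + p z) ` ball 0 1"
    and t: "0 \<le> t" "0 \<le> t'" "t + t' = 1"
  then obtain x y where x: "x \<in> ball 0 1" "u = x + p x" and y: "y \<in> ball 0 1" "v = y + p y"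
    by auto
  have t': "t' = 1 - t" "t \<le> 1" using t by auto
  define m where "m = t *\<^sub>R x + (1 - t) *\<^sub>R y"
  define w where "w = t *\<^sub>R u + (1 - t) *\<^sub>R v"
  define s where "s = t * (1 - t) * (norm (x - y))\<^sup>2"
  have s: "0 \<le> s" using t t' by (simp add: s_def)
  have xy: "(norm x)\<^sup>2 < 1" "(norm y)\<^sup>2 < 1"
    using x y by (auto simp: abs_square_less_1)
  have "t * (norm x)\<^sup>2 + (1 - t) * (norm y)\<^sup>2 < 1"
    using convex_bound_lt[OF xy, of t "1 - t"] t t' by simp
  then have "(norm m)\<^sup>2 < 1 - s"
    unfolding m_def s_def by (subst norm_convex_combination_squared) simp
  \<comment> \<open>The two sides differ by s^2/4. Taking roots, which uses s < 1, leaves room for a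
    closed ball of radius s/2 around \<open>m\<close> inside the open unit ball.\<close>
  also have "\<dots> \<le> (1 - s / 2)\<^sup>2" by (simp add: power2_eq_square algebra_simps)
  finally have "(norm m)\<^sup>2 < (1 - s / 2)\<^sup>2" .
  moreover have "s < 1" using \<open>(norm m)\<^sup>2 < 1 - s\<close> by (smt (verit) zero_le_power2)
  ultimately have m: "norm m < 1 - s / 2" using power2_less_imp_less[of "norm m" "1 - s/2"] by auto
  have sub: "z \<in> ball 0 1" if "z \<in> cball m (s / 2)" for z
  proof -
    have "norm z \<le> norm m + norm (z - m)" by (metis norm_triangle_sub)
    then show ?thesis using that m by (simp add: dist_norm norm_minus_commute)
  qed
  have mb: "m \<in> ball 0 1" using s by (intro sub) simp
  have "\<exists>!z\<in>cball m (s / 2). w - p z = z"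
  proof (rule Banach_fix)
    show "(\<lambda>z. w - p z) ` cball m (s / 2) \<subseteq> cball m (s / 2)"
    proof safe
      fix z assume z: "z \<in> cball m (s / 2)"
      \<comment> \<open>The first bracket is the defect of \<open>p\<close> from affinity at
        \<open>m\<close>, at most L s/2; the second is the Lipschitz change from \<open>m\<close> to
        \<open>z\<close>, at most C s/2.\<close>
      have "w - p z - m = (t *\<^sub>R p x + (1 - t) *\<^sub>R p y - p m) + (p m - p z)"
        by (simp add: w_def m_def x y algebra_simps)
      then have "norm (w - p z - m) \<le>
          norm (t *\<^sub>R p x + (1 - t) *\<^sub>R p y - p m) + norm (p m - p z)"
        by (metis norm_triangle_ineq)
      also have "norm (t *\<^sub>R p x + (1 - t) *\<^sub>R p y - p m) \<le> L / 2 * s"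
        unfolding m_def s_def using sec x y t t' by blast
      also have "norm (p m - p z) \<le> C * norm (m - z)" using lip mb sub[OF z] by blast
      also have "\<dots> \<le> C * (s / 2)"
        using z C by (intro mult_left_mono) (auto simp: dist_norm)
      also have "L / 2 * s + C * (s / 2) = (C + L) * (s / 2)" by (simp add: algebra_simps)
      also have "\<dots> \<le> 1 * (s / 2)" using C s by (intro mult_right_mono) auto
      finally show "w - p z \<in> cball m (s / 2)" by (simp add: dist_norm norm_minus_commute)
    qed
    show "dist (w - p z) (w - p z') \<le> C * dist z z'"
      if "z \<in> cball m (s / 2)" "z' \<in> cball m (s / 2)" for z z'
      using lip[OF sub sub, OF that] by (simp add: dist_norm norm_minus_commute)
  qed (use C s in \<open>auto simp: complete_eq_closed\<close>)
  then obtain z where "z \<in> cball m (s / 2)" "w - p z = z" by blast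
  then have "z \<in> ball 0 1" "w = z + p z" using sub by (auto simp: algebra_simps)
  then show "t *\<^sub>R u + t' *\<^sub>R v \<in> (\<lambda>z. z + p z) ` ball 0 1" unfolding t' w_def by blast
qed

section \<open>Power series on the unit disk\<close>

lemma tcoeff_0: "tcoeff h 0 = h 0"
  and tcoeff_1: "tcoeff h (Suc 0) = deriv h 0"
  by (simp_all add: tcoeff_def)

lemma tcoeff_sums:
  assumes "h holomorphic_on disk" "z \<in> disk"
  shows "(\<lambda>n. tcoeff h n * z ^ n) sums h z"
  using holomorphic_power_series[OF assms] by (simp add: tcoeff_def)

text \<open>Uniqueness of Taylor coefficients: convergence at the real points r < 1 forces the
  radius of convergence to be at least 1, so \<open>f\<close> has the formal expansion
  \<open>Abs_fps a\<close>.\<close>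

lemma power_series_disk:
  assumes sums: "\<And>z. z \<in> disk \<Longrightarrow> (\<lambda>n. a n * z ^ n) sums f z"
  shows power_series_disk_holomorphic: "f holomorphic_on disk"
    and power_series_disk_tcoeff: "tcoeff f n = a n"
proof -
  show hol: "f holomorphic_on disk"
    using sums by (intro power_series_holomorphic[of 0 1 a]) auto
  have rad: "1 \<le> conv_radius a"
  proof (rule conv_radius_geI_ex)
    fix r :: real assume "0 < r" "ereal r < 1"
    then show "\<exists>z. norm z = r \<and> summable (\<lambda>n. a n * z ^ n)"
      using sums[of "of_real r"] by (intro exI[of _ "of_real r"]) (auto simp: sums_iff)
  qed
  have "\<forall>\<^sub>F z in nhds 0. z \<in> disk" by (intro eventually_nhds_in_open) auto
  then have "f has_fps_expansion Abs_fps a"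
    unfolding has_fps_expansion_def fps_conv_radius_def
    using rad sums
    by (auto elim!: eventually_mono simp: eval_fps_def sums_iff intro: less_le_trans[of 0 1])
  from fps_nth_fps_expansion[OF this, of n] show "tcoeff f n = a n"
    by (simp add: tcoeff_def)
qed

lemma power_series_bounded_coeffs_sums:
  fixes a :: "nat \<Rightarrow> complex"
  assumes "\<And>n. norm (a n) \<le> 1" "z \<in> disk"
  shows "(\<lambda>n. a n * z ^ n) sums (\<Sum>n. a n * z ^ n)"
proof (rule summable_sums, rule summable_comparison_test')
  show "summable (\<lambda>n. norm z ^ n)" using assms by (intro summable_geometric) auto
  show "norm (a n * z ^ n) \<le> norm z ^ n" for n
    using mult_right_mono[OF assms(1), of "norm z ^ n" n] by (simp add: norm_mult norm_power)
qed

text \<open>The bounds by 1 give a geometric majorant, so the \<open>suminf\<close> in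
  \<open>aconv\<close> converges on the whole disk and really is a Taylor series.\<close>

lemma
  assumes "\<And>n. norm (tcoeff f n) \<le> 1" "\<And>n. norm (tcoeff F n) \<le> 1"
  shows aconv_holomorphic: "aconv f F holomorphic_on disk"
    and tcoeff_aconv: "tcoeff (aconv f F) n = tcoeff f n * tcoeff F n"
proof -
  have "norm (tcoeff f n * tcoeff F n) \<le> 1" for n
    using mult_mono[OF assms(1)[of n] assms(2)[of n]] by (simp add: norm_mult)
  then have *: "(\<lambda>n. (tcoeff f n * tcoeff F n) * z ^ n) sums aconv f F z" if "z \<in> disk" for z
    unfolding aconv_def using that by (intro power_series_bounded_coeffs_sums) auto
  show "aconv f F holomorphic_on disk" by (rule power_series_disk_holomorphic[OF *])
  show "tcoeff (aconv f F) n = tcoeff f n * tcoeff F n" by (rule power_series_disk_tcoeff[OF *])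
qed

section \<open>First and second differences of power series\<close>

text \<open>Sums |x^k - y^k| <= k |x - y| over the terms. The exponents \<open>k n\<close> are left
  free so that a series starting in degree 2 can be indexed from 0.\<close>

lemma power_series_lipschitz:
  fixes a :: "nat \<Rightarrow> complex"
  assumes "norm x \<le> 1" "norm y \<le> 1"
    and q: "(\<lambda>n. a n * x ^ k n) sums qx" "(\<lambda>n. a n * y ^ k n) sums qy"
    and a: "(\<lambda>n. real (k n) * norm (a n)) sums A"
  shows "norm (qx - qy) \<le> A * norm (x - y)"
proof (rule norm_sums_le)
  show "(\<lambda>n. a n * x ^ k n - a n * y ^ k n) sums (qx - qy)" using q by (rule sums_diff)
  show "(\<lambda>n. real (k n) * norm (a n) * norm (x - y)) sums (A * norm (x - y))"
    using a by (rule sums_mult2)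
  show "norm (a n * x ^ k n - a n * y ^ k n) \<le> real (k n) * norm (a n) * norm (x - y)" for n
    using mult_left_mono[OF norm_power_diff[OF assms(1,2), of "k n"], of "norm (a n)"]
    by (simp add: norm_mult flip: right_diff_distrib) (simp add: mult_ac)
qed

text \<open>The factor n(n - 1) bounds the second derivative of z^n on the closed disk. Induction on
  \<open>n\<close> replaces any appeal to calculus.\<close>

lemma power_second_difference:
  fixes x y :: complex
  assumes "norm x \<le> 1" "norm y \<le> 1" "0 \<le> t" "t \<le> 1"
  shows "norm (t *\<^sub>R x ^ n + (1 - t) *\<^sub>R y ^ n - (t *\<^sub>R x + (1 - t) *\<^sub>R y) ^ n) \<le>
    real n * (real n - 1) / 2 * (t * (1 - t) * (norm (x - y))\<^sup>2)"
proof (induction n)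
  case 0
  show ?case by (simp flip: scaleR_left.add)
next
  case (Suc n)
  let ?m = "t *\<^sub>R x + (1 - t) *\<^sub>R y" and ?s = "t * (1 - t) * (norm (x - y))\<^sup>2"
  let ?E = "\<lambda>n. t *\<^sub>R x ^ n + (1 - t) *\<^sub>R y ^ n - ?m ^ n"
  have m: "norm ?m \<le> 1"
  proof -
    have "norm ?m \<le> t * norm x + (1 - t) * norm y"
      using norm_triangle_ineq[of "t *\<^sub>R x" "(1 - t) *\<^sub>R y"] assms by simp
    also have "\<dots> \<le> 1" using assms by (intro convex_bound_le) auto
    finally show ?thesis .
  qed
  \<comment> \<open>Comes from x - m = (1 - t)(x - y) and y - m = -t(x - y). The new term
    contributes \<open>n\<close>, and n(n - 1)/2 + n = (n + 1)n/2.\<close>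
  have "?E (Suc n) = ?m * ?E n + (t * (1 - t)) *\<^sub>R ((x - y) * (x ^ n - y ^ n))"
    by (simp add: scaleR_conv_of_real) algebra
  then have "norm (?E (Suc n)) \<le> norm (?m * ?E n) + norm ((t * (1 - t)) *\<^sub>R ((x - y) * (x ^ n - y ^ n)))"
    by (metis norm_triangle_ineq)
  also have "norm (?m * ?E n) \<le> 1 * norm (?E n)"
    unfolding norm_mult using m by (intro mult_right_mono) auto
  also have "1 * norm (?E n) \<le> real n * (real n - 1) / 2 * ?s" using Suc.IH by simp
  also have "norm ((t * (1 - t)) *\<^sub>R ((x - y) * (x ^ n - y ^ n))) =
      t * (1 - t) * (norm (x - y) * norm (x ^ n - y ^ n))"
    using assms by (simp add: norm_mult)
  also have "\<dots> \<le> t * (1 - t) * (norm (x - y) * (real n * norm (x - y)))"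
    using assms by (intro mult_left_mono norm_power_diff) auto
  also have "real n * (real n - 1) / 2 * ?s + t * (1 - t) * (norm (x - y) * (real n * norm (x - y)))
      = real (Suc n) * (real (Suc n) - 1) / 2 * ?s"
    by (simp add: power2_eq_square field_simps)
  finally show ?case by simp
qed

lemma power_series_second_difference:
  fixes a :: "nat \<Rightarrow> complex"
  assumes xyt: "norm x \<le> 1" "norm y \<le> 1" "0 \<le> t" "t \<le> 1"
    and q: "(\<lambda>n. a n * x ^ k n) sums qx" "(\<lambda>n. a n * y ^ k n) sums qy"
      "(\<lambda>n. a n * (t *\<^sub>R x + (1 - t) *\<^sub>R y) ^ k n) sums qm"
    and a: "(\<lambda>n. real (k n) * (real (k n) - 1) * norm (a n)) sums A"
  shows "norm (t *\<^sub>R qx + (1 - t) *\<^sub>R qy - qm) \<le> A / 2 * (t * (1 - t) * (norm (x - y))\<^sup>2)"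
proof (rule norm_sums_le)
  let ?m = "t *\<^sub>R x + (1 - t) *\<^sub>R y" and ?s = "t * (1 - t) * (norm (x - y))\<^sup>2"
  let ?E = "\<lambda>n. t *\<^sub>R (a n * x ^ k n) + (1 - t) *\<^sub>R (a n * y ^ k n) - a n * ?m ^ k n"
  show "?E sums (t *\<^sub>R qx + (1 - t) *\<^sub>R qy - qm)"
    using q by (intro sums_diff sums_add sums_scaleR_right)
  show "(\<lambda>n. real (k n) * (real (k n) - 1) * norm (a n) / 2 * ?s) sums (A / 2 * ?s)"
    using a by (intro sums_mult2 sums_divide)
  show "norm (?E n) \<le> real (k n) * (real (k n) - 1) * norm (a n) / 2 * ?s" for n
  proof -
    have "?E n = a n * (t *\<^sub>R x ^ k n + (1 - t) *\<^sub>R y ^ k n - ?m ^ k n)"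
      by (simp add: algebra_simps)
    then have "norm (?E n) = norm (a n) * norm (t *\<^sub>R x ^ k n + (1 - t) *\<^sub>R y ^ k n - ?m ^ k n)"
      by (simp add: norm_mult)
    also have "\<dots> \<le> norm (a n) * (real (k n) * (real (k n) - 1) / 2 * ?s)"
      using xyt by (intro mult_left_mono power_second_difference) auto
    finally show ?thesis by (simp add: field_simps)
  qed
qed

section \<open>Coefficients of convex univalent functions\<close>

text \<open>\<open>\<omega> ^ m\<close> is an n-th root of unity, equal to 1 exactly when n divides
  m; otherwise the geometric sum vanishes. Averaging thus filters out the exponents that are
  multiples of n.\<close>

lemma average_roots_of_unity:
  fixes \<omega> :: complex
  assumes n: "1 \<le> n" and \<omega>: "\<omega> = exp (2 * of_real pi * \<i> / of_nat n)"
  shows "(\<Sum>k<n. (\<omega> ^ k) ^ m) / of_nat n = (if n dvd m then 1 else 0)"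
proof -
  have pow: "\<omega> ^ j = exp (2 * of_real pi * \<i> * of_nat j / of_nat n)" for j
    unfolding \<omega> by (simp add: exp_of_nat_mult[symmetric] field_simps)
  have "\<omega> ^ n = 1"
    using complex_root_unity_eq_1[OF n, of n] by (simp add: pow)
  then have *: "(\<omega> ^ m) ^ n = 1" by (metis mult.commute power_mult power_one)
  have "(\<Sum>k<n. (\<omega> ^ k) ^ m) = (\<Sum>k<n. (\<omega> ^ m) ^ k)"
    by (simp add: mult.commute flip: power_mult)
  also have "\<dots> = (if n dvd m then of_nat n else 0)"
  proof (cases "n dvd m")
    case True
    then show ?thesis using complex_root_unity_eq_1[OF n, of m] by (simp add: pow)
  next
    case False
    then have "\<omega> ^ m \<noteq> 1" using complex_root_unity_eq_1[OF n, of m] by (simp add: pow)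
    then show ?thesis using False * by (simp add: geometric_sum)
  qed
  finally show ?thesis using n by simp
qed

lemma classK_coeff_le_1:
  assumes "\<phi> \<in> classK"
  shows "norm (tcoeff \<phi> n) \<le> 1"
proof (cases "n = 0")
  case True
  then show ?thesis using assms by (simp add: tcoeff_0 classK_def)
next
  case False
  then have n: "1 \<le> n" by simp
  have hol: "\<phi> holomorphic_on disk" and \<phi>0: "\<phi> 0 = 0" "deriv \<phi> 0 = 1"
    and inj: "inj_on \<phi> disk" and conv: "convex (\<phi> ` disk)"
    using assms by (auto simp: classK_def)
  define \<omega> :: complex where "\<omega> = exp (2 * of_real pi * \<i> / of_nat n)"
  have \<omega>: "norm \<omega> = 1" by (simp add: \<omega>_def norm_exp_eq_Re)
  \<comment> \<open>Keeping only every n-th coefficient moves the n-th coefficient of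
    \<open>\<phi>\<close> to degree 1, where the Schwarz lemma bounds it.\<close>
  define \<psi> where "\<psi> = (\<lambda>z. \<Sum>j. tcoeff \<phi> (n * j) * z ^ j)"
  have \<psi>: "(\<lambda>j. tcoeff \<phi> (n * j) * z ^ j) sums \<psi> z \<and> \<psi> z \<in> \<phi> ` disk" if z: "z \<in> disk" for z
  proof -
    \<comment> \<open>The points \<open>\<omega> ^ k * u\<close> are the n-th roots of
      \<open>z\<close>, and \<open>\<psi> z\<close> is the mean of \<open>\<phi>\<close> over
      them.\<close>
    obtain u where u: "u ^ n = z"
      using exists_complex_root[of n z] n by auto
    have ud: "u \<in> disk"
    proof (rule ccontr)
      assume "u \<notin> disk"
      then have "1 \<le> norm u ^ n" by (intro one_le_power) auto
      then show False using u z by (auto simp flip: norm_power)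
    qed
    have \<omega>u: "\<omega> ^ k * u \<in> disk" for k
      using ud by (simp add: norm_mult norm_power \<omega>)
    let ?avg = "\<Sum>k<n. (1 / real n) *\<^sub>R \<phi> (\<omega> ^ k * u)"
    have "(\<lambda>m. \<Sum>k<n. (1 / real n) *\<^sub>R (tcoeff \<phi> m * (\<omega> ^ k * u) ^ m)) sums ?avg"
      by (intro sums_sum sums_scaleR_right tcoeff_sums hol \<omega>u)
    also have "(\<lambda>m. \<Sum>k<n. (1 / real n) *\<^sub>R (tcoeff \<phi> m * (\<omega> ^ k * u) ^ m)) =
        (\<lambda>m. if n dvd m then tcoeff \<phi> m * u ^ m else 0)"
    proof
      fix m
      have "(\<Sum>k<n. (1 / real n) *\<^sub>R (tcoeff \<phi> m * (\<omega> ^ k * u) ^ m)) =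
          tcoeff \<phi> m * u ^ m * ((\<Sum>k<n. (\<omega> ^ k) ^ m) / of_nat n)"
        by (simp add: scaleR_conv_of_real sum_distrib_left sum_divide_distrib power_mult_distrib mult_ac)
      then show "(\<Sum>k<n. (1 / real n) *\<^sub>R (tcoeff \<phi> m * (\<omega> ^ k * u) ^ m)) =
          (if n dvd m then tcoeff \<phi> m * u ^ m else 0)"
        unfolding average_roots_of_unity[OF n \<omega>_def] by simp
    qed
    finally have "(\<lambda>m. if n dvd m then tcoeff \<phi> m * u ^ m else 0) sums ?avg" .
    moreover have "strict_mono (\<lambda>j. n * j)" using n by (simp add: strict_mono_def)
    ultimately have "(\<lambda>j. if n dvd n * j then tcoeff \<phi> (n * j) * u ^ (n * j) else 0) sums ?avg"
      by (subst sums_mono_reindex) auto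
    then have sums: "(\<lambda>j. tcoeff \<phi> (n * j) * z ^ j) sums ?avg"
      by (simp add: power_mult u)
    \<comment> \<open>Convexity of the image enters here: the mean is a convex combination of values
      of \<open>\<phi>\<close>.\<close>
    have "?avg \<in> \<phi> ` disk"
      using n \<omega>u by (intro convex_sum conv) auto
    then show ?thesis using sums by (simp add: \<psi>_def sums_iff)
  qed
  have hol\<psi>: "\<psi> holomorphic_on disk" and co: "\<And>j. tcoeff \<psi> j = tcoeff \<phi> (n * j)"
    using power_series_disk[of "\<lambda>j. tcoeff \<phi> (n * j)" \<psi>] \<psi> by blast+
  have \<psi>0: "\<psi> 0 = 0" using co[of 0] \<phi>0 by (simp add: tcoeff_0)
  have d\<psi>: "deriv \<psi> 0 = tcoeff \<phi> n" using co[of 1] by (simp add: tcoeff_1)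
  obtain g where g: "g holomorphic_on \<phi> ` disk" "\<And>z. z \<in> disk \<Longrightarrow> deriv \<phi> z * deriv g (\<phi> z) = 1"
      "\<And>z. z \<in> disk \<Longrightarrow> g (\<phi> z) = z"
    using holomorphic_has_inverse[OF hol open_ball inj] by blast
  have opn: "open (\<phi> ` disk)" by (rule open_mapping_thm3[OF hol open_ball inj])
  have g0: "g 0 = 0" "deriv g 0 = 1" using g(2,3)[of 0] \<phi>0 by auto
  have "norm (deriv (g \<circ> \<psi>) 0) \<le> 1"
  proof (rule Schwarz_Lemma(2)[where \<xi> = 0])
    show "(g \<circ> \<psi>) holomorphic_on disk"
      using \<psi> by (intro holomorphic_on_compose_gen[OF hol\<psi> g(1)]) auto
    show "norm ((g \<circ> \<psi>) z) < 1" if "norm z < 1" for z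
    proof -
      obtain v where "v \<in> disk" "\<psi> z = \<phi> v" using \<psi>[of z] \<open>norm z < 1\<close> by auto
      then show ?thesis using g(3)[of v] by simp
    qed
  qed (auto simp: \<psi>0 g0)
  \<comment> \<open>Since \<open>g\<close> inverts \<open>\<phi>\<close> and
    \<open>deriv \<phi> 0 = 1\<close>, the first factor is 1, so this derivative is the n-th
    coefficient of \<open>\<phi>\<close>.\<close>
  moreover have "deriv (g \<circ> \<psi>) 0 = deriv g (\<psi> 0) * deriv \<psi> 0"
  proof (rule deriv_chain)
    show "\<psi> field_differentiable at 0"
      using hol\<psi> by (rule holomorphic_on_imp_differentiable_at) auto
    show "g field_differentiable at (\<psi> 0)"
      using g(1) opn by (rule holomorphic_on_imp_differentiable_at) (use \<psi>[of 0] in auto)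
  qed
  ultimately show ?thesis by (simp add: \<psi>0 g0 d\<psi>)
qed

section \<open>Coefficient classes and convolution\<close>

text \<open>Common form of \<open>classU\<close> (weight n) and \<open>classV\<close> (weight n^2),
  so that convolution is treated once for both.\<close>

definition classW :: "(nat \<Rightarrow> real) \<Rightarrow> harm set" where
  "classW w = {(h, g). (h, g) \<in> classH \<and>
     summable (\<lambda>n. w (n + 2) * (norm (tcoeff h (n + 2)) + norm (tcoeff g (n + 2)))) \<and>
     (\<Sum>n. w (n + 2) * (norm (tcoeff h (n + 2)) + norm (tcoeff g (n + 2)))) \<le> 1}"

lemma classU_eq: "classU = classW real"
  and classV_eq: "classV = classW (\<lambda>n. real n ^ 2)"
  by (simp_all add: classU_def classV_def classW_def)

lemma classW_coeff:
  assumes f: "(h, g) \<in> classW w" and w: "\<And>n. n \<ge> 2 \<Longrightarrow> 0 \<le> w n" and n: "n \<ge> 2"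
  shows "w n * (norm (tcoeff h n) + norm (tcoeff g n)) \<le> 1"
proof -
  let ?c = "\<lambda>n. w (n + 2) * (norm (tcoeff h (n + 2)) + norm (tcoeff g (n + 2)))"
  have "sum ?c {n - 2} \<le> suminf ?c"
    using f w by (intro sum_le_suminf) (auto simp: classW_def)
  also have "\<dots> \<le> 1" using f by (simp add: classW_def)
  finally show ?thesis using le_add_diff_inverse2[OF n] by (simp del: le_add_diff_inverse2)
qed

text \<open>Supplies the bounds under which \<open>tcoeff_aconv\<close> applies. Degrees 0 and 1
  come from the normalization, higher degrees from the weighted sum.\<close>

lemma classW_coeff_le_1:
  assumes f: "(h, g) \<in> classW w" and w: "\<And>n. n \<ge> 2 \<Longrightarrow> 1 \<le> w n"
  shows "norm (tcoeff h n) \<le> 1" "norm (tcoeff g n) \<le> 1"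
proof -
  have "norm (tcoeff h n) \<le> 1 \<and> norm (tcoeff g n) \<le> 1"
  proof (cases "n \<ge> 2")
    case True
    have "1 * (norm (tcoeff h n) + norm (tcoeff g n)) \<le> w n * (norm (tcoeff h n) + norm (tcoeff g n))"
      using w[OF True] by (intro mult_right_mono) auto
    also have "\<dots> \<le> 1"
      using True w by (intro classW_coeff[OF f]) (auto intro: order_trans[of 0 1])
    finally have "norm (tcoeff h n) + norm (tcoeff g n) \<le> 1" by simp
    then show ?thesis using norm_ge_zero[of "tcoeff h n"] norm_ge_zero[of "tcoeff g n"]
      by (intro conjI) linarith+
  next
    case False
    then have "n = 0 \<or> n = Suc 0" by auto
    then show ?thesis using f by (auto simp: tcoeff_0 tcoeff_1 classW_def classH_def)
  qed
  then show "norm (tcoeff h n) \<le> 1" "norm (tcoeff g n) \<le> 1" by auto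
qed

lemma classU_coeff:
  assumes f: "(h, g) \<in> classU" and n: "n \<ge> 2"
  shows "real n * norm (tcoeff h n) \<le> 1" "real n * norm (tcoeff g n) \<le> 1"
proof -
  have "real n * (norm (tcoeff h n) + norm (tcoeff g n)) \<le> 1"
    using f n by (intro classW_coeff) (auto simp: classU_eq)
  moreover have "0 \<le> real n * norm (tcoeff h n)" "0 \<le> real n * norm (tcoeff g n)" by auto
  ultimately show "real n * norm (tcoeff h n) \<le> 1" "real n * norm (tcoeff g n) \<le> 1"
    unfolding distrib_left by linarith+
qed

lemma classW_mono_coeffs:
  assumes f: "(h, g) \<in> classW w" and f': "(h', g') \<in> classH"
    and w': "\<And>n. n \<ge> 2 \<Longrightarrow> 0 \<le> w' n"
    and h: "\<And>n. n \<ge> 2 \<Longrightarrow> w' n * norm (tcoeff h' n) \<le> w n * norm (tcoeff h n)"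
    and g: "\<And>n. n \<ge> 2 \<Longrightarrow> w' n * norm (tcoeff g' n) \<le> w n * norm (tcoeff g n)"
  shows "(h', g') \<in> classW w'"
proof -
  let ?c = "\<lambda>n. w (n + 2) * (norm (tcoeff h (n + 2)) + norm (tcoeff g (n + 2)))"
  let ?c' = "\<lambda>n. w' (n + 2) * (norm (tcoeff h' (n + 2)) + norm (tcoeff g' (n + 2)))"
  have le: "?c' n \<le> ?c n" for n
    using add_mono[OF h[of "n + 2"] g[of "n + 2"]] by (simp add: distrib_left)
  have c: "summable ?c" "suminf ?c \<le> 1" using f by (auto simp: classW_def)
  have "norm (?c' n) \<le> ?c n" for n using le[of n] w'[of "n + 2"] by simp
  then have c': "summable ?c'" by (intro summable_comparison_test'[OF c(1)])
  have "suminf ?c' \<le> suminf ?c" by (rule suminf_le[OF le c' c(1)])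
  with c' c(2) f' show ?thesis by (simp add: classW_def)
qed

lemma classW_antimono:
  assumes "f \<in> classW w" "\<And>n. n \<ge> 2 \<Longrightarrow> 0 \<le> w' n" "\<And>n. n \<ge> 2 \<Longrightarrow> w' n \<le> w n"
  shows "f \<in> classW w'"
proof -
  obtain h g where f: "f = (h, g)" by (cases f)
  show ?thesis
    unfolding f by (rule classW_mono_coeffs[of h g w]) (use assms in \<open>auto simp: f classW_def intro: mult_right_mono\<close>)
qed

lemma classV_subset_classU: "classV \<subseteq> classU"
  unfolding classU_eq classV_eq by (auto elim!: classW_antimono simp: power2_eq_square)

text \<open>Decay of the multipliers pays for a change of weight. The case w = n, w' = n^2 with
  coefficients at most 1/n serves \<open>hconv\<close>; the case w' = w with coefficients at most 1
  serves \<open>tconv\<close>.\<close>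

lemma aconv_classW:
  assumes f: "(h, g) \<in> classW w" and w: "\<And>n. n \<ge> 2 \<Longrightarrow> 1 \<le> w n"
    and w': "\<And>n. n \<ge> 2 \<Longrightarrow> 0 \<le> w' n"
    and bnd: "\<And>n. norm (tcoeff \<phi> n) \<le> 1" "\<And>n. norm (tcoeff \<psi> n) \<le> 1"
    and one: "tcoeff \<phi> 1 = 1"
    and \<phi>: "\<And>n. n \<ge> 2 \<Longrightarrow> w' n * norm (tcoeff \<phi> n) \<le> w n"
    and \<psi>: "\<And>n. n \<ge> 2 \<Longrightarrow> w' n * norm (tcoeff \<psi> n) \<le> w n"
  shows "(aconv h \<phi>, aconv g \<psi>) \<in> classW w'"
proof (rule classW_mono_coeffs[OF f _ w'])
  note fb = classW_coeff_le_1[OF f w]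
  note ch = tcoeff_aconv[of h \<phi>, OF fb(1) bnd(1)] and cg = tcoeff_aconv[of g \<psi>, OF fb(2) bnd(2)]
  have H: "h 0 = 0" "g 0 = 0" "deriv h 0 = 1" "deriv g 0 = 0"
    using f by (auto simp: classW_def classH_def)
  show "(aconv h \<phi>, aconv g \<psi>) \<in> classH"
    using ch[of 0] ch[of 1] cg[of 0] cg[of 1] H one
      aconv_holomorphic[of h \<phi>, OF fb(1) bnd(1)] aconv_holomorphic[of g \<psi>, OF fb(2) bnd(2)]
    by (simp add: classH_def tcoeff_0 tcoeff_1)
  fix n :: nat assume n: "n \<ge> 2"
  show "w' n * norm (tcoeff (aconv h \<phi>) n) \<le> w n * norm (tcoeff h n)"
    using mult_right_mono[OF \<phi>[OF n], of "norm (tcoeff h n)"] by (simp add: ch norm_mult mult_ac)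
  show "w' n * norm (tcoeff (aconv g \<psi>) n) \<le> w n * norm (tcoeff g n)"
    using mult_right_mono[OF \<psi>[OF n], of "norm (tcoeff g n)"] by (simp add: cg norm_mult mult_ac)
qed

text \<open>The bound 1/n on the coefficients of \<open>f2\<close> turns the weight n available for
  \<open>f1\<close> into n^2. With \<open>classV_subset_classU\<close> this yields both closure
  statements as well.\<close>

lemma hconv_classU_classV:
  assumes "f1 \<in> classU" "f2 \<in> classU"
  shows "hconv f1 f2 \<in> classV"
proof -
  obtain h g \<phi> \<psi> where f: "f1 = (h, g)" "f2 = (\<phi>, \<psi>)" by (cases f1, cases f2)
  note W = assms[unfolded f classU_eq]
  have "tcoeff \<phi> 1 = 1" using W(2) by (auto simp: tcoeff_1 classW_def classH_def)
  moreover have "norm (tcoeff \<phi> n) \<le> 1" "norm (tcoeff \<psi> n) \<le> 1" for n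
    using classW_coeff_le_1[OF W(2)] by auto
  moreover have "real n ^ 2 * norm (tcoeff \<phi> n) \<le> real n" "real n ^ 2 * norm (tcoeff \<psi> n) \<le> real n"
    if "n \<ge> 2" for n
    using classU_coeff[OF assms(2)[unfolded f] that, THEN mult_left_mono, of "real n"]
    by (simp_all add: power2_eq_square mult_ac)
  ultimately show ?thesis
    unfolding f hconv_def classV_eq using W(1) by (auto intro!: aconv_classW)
qed

lemma tconv_classW:
  assumes "\<phi> \<in> classK" "f \<in> classW w" "\<And>n. n \<ge> 2 \<Longrightarrow> 1 \<le> w n"
  shows "tconv \<phi> f \<in> classW w"
proof -
  obtain h g where f: "f = (h, g)" by (cases f)
  have w: "0 \<le> w n" if "n \<ge> 2" for n using assms(3)[OF that] by simp
  have "w n * norm (tcoeff \<phi> n) \<le> w n" if "n \<ge> 2" for n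
    using mult_left_mono[OF classK_coeff_le_1[OF assms(1), of n] w[OF that]] by simp
  moreover have "tcoeff \<phi> 1 = 1" using assms(1) by (simp add: tcoeff_1 classK_def)
  ultimately show ?thesis
    using assms w classK_coeff_le_1[OF assms(1)] unfolding f tconv_def
    by (auto intro!: aconv_classW)
qed

section \<open>Univalence and convexity for the weight n^2\<close>

lemma norm_deriv_le_lipschitz:
  fixes f :: "complex \<Rightarrow> complex"
  assumes "f field_differentiable at z" "open S" "z \<in> S"
    and lip: "\<And>x y. x \<in> S \<Longrightarrow> y \<in> S \<Longrightarrow> norm (f x - f y) \<le> C * norm (x - y)"
  shows "norm (deriv f z) \<le> C"
proof (rule Lim_norm_ubound)
  show "((\<lambda>y. (f y - f z) / (y - z)) \<longlongrightarrow> deriv f z) (at z)"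
    using assms(1) by (simp add: field_differentiable_derivI flip: has_field_derivative_iff)
  have "\<forall>\<^sub>F y in at z. y \<in> S" using assms(2,3) by (rule eventually_at_in_open')
  moreover have "\<forall>\<^sub>F y in at z. y \<noteq> z" by (simp add: eventually_at_filter)
  ultimately show "\<forall>\<^sub>F y in at z. norm ((f y - f z) / (y - z)) \<le> C"
    by eventually_elim (use lip assms(3) in \<open>simp add: norm_divide divide_le_eq\<close>)
qed simp

text \<open>The splitting n^2 = n + n(n - 1) divides the budget 1 into a Lipschitz constant and a
  second-difference constant, as \<open>convex_image_id_plus_contraction\<close> requires.\<close>

lemma classV_subset_classSK: "classV \<subseteq> classSK"
proof
  fix f assume fV: "f \<in> classV"
  obtain h g where f: "f = (h, g)" by (cases f)
  have fH: "(h, g) \<in> classH" using fV by (simp add: f classV_def)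
  then have hol: "h holomorphic_on disk" "g holomorphic_on disk"
    and H: "h 0 = 0" "g 0 = 0" "deriv h 0 = 1" "deriv g 0 = 0"
    by (auto simp: classH_def)
  define a where "a = (\<lambda>n. tcoeff h (n + 2))"
  define b where "b = (\<lambda>n. tcoeff g (n + 2))"
  define q where "q = (\<lambda>z. h z - z)"
  have q: "(\<lambda>n. a n * z ^ (n + 2)) sums q z" and g: "(\<lambda>n. b n * z ^ (n + 2)) sums g z"
    if "z \<in> disk" for z
    using tcoeff_sums[OF hol(1) that, THEN sums_split_initial_segment, of 2]
      tcoeff_sums[OF hol(2) that, THEN sums_split_initial_segment, of 2]
    by (simp_all add: a_def b_def q_def numeral_2_eq_2 tcoeff_0 tcoeff_1 H)
  let ?k = "\<lambda>n. real (n + 2)"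
  have V: "summable (\<lambda>n. ?k n ^ 2 * (norm (a n) + norm (b n)))"
      "(\<Sum>n. ?k n ^ 2 * (norm (a n) + norm (b n))) \<le> 1"
    using fV by (simp_all add: f classV_def a_def b_def)
  \<comment> \<open>Applied below to the weights k and k(k - 1), both dominated by k^2.\<close>
  have wsum: "summable (\<lambda>n. w n * norm (a n))" "summable (\<lambda>n. w n * norm (b n))"
    if "\<And>n. 0 \<le> w n \<and> w n \<le> ?k n ^ 2" for w :: "nat \<Rightarrow> real"
  proof -
    have "w n * norm (a n) \<le> ?k n ^ 2 * (norm (a n) + norm (b n))"
        "w n * norm (b n) \<le> ?k n ^ 2 * (norm (a n) + norm (b n))" for n
      using that[of n] by (auto intro!: mult_mono)
    then show "summable (\<lambda>n. w n * norm (a n))" "summable (\<lambda>n. w n * norm (b n))"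
      using that by (auto intro!: summable_comparison_test'[OF V(1)] simp: abs_mult)
  qed
  have k1: "0 \<le> ?k n \<and> ?k n \<le> ?k n ^ 2" "0 \<le> ?k n * (?k n - 1) \<and> ?k n * (?k n - 1) \<le> ?k n ^ 2" for n
    by (auto simp: power2_eq_square algebra_simps)
  define A B A2 B2 where "A = (\<Sum>n. ?k n * norm (a n))" and "B = (\<Sum>n. ?k n * norm (b n))"
    and "A2 = (\<Sum>n. ?k n * (?k n - 1) * norm (a n))" and "B2 = (\<Sum>n. ?k n * (?k n - 1) * norm (b n))"
  have A: "(\<lambda>n. ?k n * norm (a n)) sums A" and B: "(\<lambda>n. ?k n * norm (b n)) sums B"
    unfolding A_def B_def using wsum[OF k1(1)] by (auto intro: summable_sums)
  have A2: "(\<lambda>n. ?k n * (?k n - 1) * norm (a n)) sums A2"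
    and B2: "(\<lambda>n. ?k n * (?k n - 1) * norm (b n)) sums B2"
    unfolding A2_def B2_def using wsum[OF k1(2)] by (auto intro: summable_sums)
  have "(\<lambda>n. (?k n * norm (a n) + ?k n * norm (b n)) +
      (?k n * (?k n - 1) * norm (a n) + ?k n * (?k n - 1) * norm (b n))) sums ((A + B) + (A2 + B2))"
    by (intro sums_add A B A2 B2)
  also have "(\<lambda>n. (?k n * norm (a n) + ?k n * norm (b n)) +
      (?k n * (?k n - 1) * norm (a n) + ?k n * (?k n - 1) * norm (b n))) =
      (\<lambda>n. ?k n ^ 2 * (norm (a n) + norm (b n)))"
    by (simp add: power2_eq_square algebra_simps)
  finally have tot: "(A + B) + (A2 + B2) \<le> 1" using V(2) by (simp add: sums_iff)
  have nonneg: "0 \<le> A" "0 \<le> B"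
    by (rule sums_le[OF _ sums_zero A] sums_le[OF _ sums_zero B]; simp)+
  \<comment> \<open>All degrees are at least 2, so the first-order sums are at most the second-order
    ones. Hence A + B is at most 1/2, which gives a strict contraction.\<close>
  have k2: "?k n \<le> ?k n * (?k n - 1)" for n by (simp add: algebra_simps)
  have "A \<le> A2" by (rule sums_le[OF mult_right_mono[OF k2] A A2]) simp
  moreover have "B \<le> B2" by (rule sums_le[OF mult_right_mono[OF k2] B B2]) simp
  ultimately have AB: "A + B < 1" using tot by linarith
  have lipq: "norm (q x - q y) \<le> A * norm (x - y)" and lipg: "norm (g x - g y) \<le> B * norm (x - y)"
    if "x \<in> disk" "y \<in> disk" for x y
    using that power_series_lipschitz[OF _ _ q q A] power_series_lipschitz[OF _ _ g g B]
    by auto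
  have sense: "norm (deriv g z) < norm (deriv h z)" if z: "z \<in> disk" for z
  proof -
    have d: "h field_differentiable at z" "g field_differentiable at z"
      using hol z by (auto intro: holomorphic_on_imp_differentiable_at)
    have dq: "q field_differentiable at z" "deriv q z = deriv h z - 1"
      unfolding q_def using d by (auto intro!: derivative_intros)
    have "norm (deriv q z) \<le> A"
      by (rule norm_deriv_le_lipschitz[OF dq(1) open_ball z lipq])
    moreover have "norm (deriv g z) \<le> B"
      by (rule norm_deriv_le_lipschitz[OF d(2) open_ball z lipg])
    \<comment> \<open>From h' - q' = 1: |h'| >= 1 - A > B >= |g'|.\<close>
    moreover have "1 \<le> norm (deriv h z) + norm (deriv q z)"
      using norm_triangle_ineq4[of "deriv h z" "deriv q z"] by (simp add: dq)
    ultimately show ?thesis using AB by linarith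
  qed
  have main: "inj_on (\<lambda>z. h z + c * cnj (g z)) disk \<and> convex ((\<lambda>z. h z + c * cnj (g z)) ` disk)"
    if c: "norm c = 1" for c
  proof -
    \<comment> \<open>Conjugation makes \<open>p\<close> non-analytic in general, so the
      perturbation lemmas were stated with real scalars and norms only. A factor of modulus 1 and
      \<open>cnj\<close> preserve all norms.\<close>
    define p where "p = (\<lambda>z. q z + c * cnj (g z))"
    have eq: "(\<lambda>z. h z + c * cnj (g z)) = (\<lambda>z. z + p z)" by (simp add: p_def q_def)
    have lip: "norm (p x - p y) \<le> (A + B) * norm (x - y)" if "x \<in> disk" "y \<in> disk" for x y
    proof -
      have "p x - p y = (q x - q y) + c * cnj (g x - g y)" by (simp add: p_def algebra_simps)
      then have "norm (p x - p y) \<le> norm (q x - q y) + norm (c * cnj (g x - g y))"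
        by (metis norm_triangle_ineq)
      also have "norm (c * cnj (g x - g y)) = norm (g x - g y)"
        by (simp only: norm_mult c complex_mod_cnj)
      finally show ?thesis using lipq[OF that] lipg[OF that] by (simp add: distrib_right)
    qed
    have sec: "norm (t *\<^sub>R p x + (1 - t) *\<^sub>R p y - p (t *\<^sub>R x + (1 - t) *\<^sub>R y)) \<le>
        (A2 + B2) / 2 * (t * (1 - t) * (norm (x - y))\<^sup>2)"
      if xyt: "x \<in> disk" "y \<in> disk" "0 \<le> t" "t \<le> 1" for x y t
    proof -
      let ?m = "t *\<^sub>R x + (1 - t) *\<^sub>R y" and ?s = "t * (1 - t) * (norm (x - y))\<^sup>2"
      have m: "?m \<in> disk" using convexD[OF convex_ball xyt(1,2)] xyt by simp
      let ?Eq = "t *\<^sub>R q x + (1 - t) *\<^sub>R q y - q ?m" and ?Eg = "t *\<^sub>R g x + (1 - t) *\<^sub>R g y - g ?m"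
      have "t *\<^sub>R p x + (1 - t) *\<^sub>R p y - p ?m = ?Eq + c * cnj ?Eg"
        by (simp add: p_def scaleR_conv_of_real algebra_simps)
      then have "norm (t *\<^sub>R p x + (1 - t) *\<^sub>R p y - p ?m) \<le> norm ?Eq + norm (c * cnj ?Eg)"
        by (metis norm_triangle_ineq)
      also have "norm (c * cnj ?Eg) = norm ?Eg" by (simp only: norm_mult c complex_mod_cnj)
      also have "norm ?Eq \<le> A2 / 2 * ?s"
        using xyt by (intro power_series_second_difference[OF _ _ _ _ q q q A2] m) auto
      also have "norm ?Eg \<le> B2 / 2 * ?s"
        using xyt by (intro power_series_second_difference[OF _ _ _ _ g g g B2] m) auto
      finally show ?thesis by (simp add: add_divide_distrib distrib_right)
    qed
    show ?thesis
      unfolding eq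
      using inj_on_id_plus_contraction[of disk p "A + B", OF lip AB]
        convex_image_id_plus_contraction[of p "A + B" "A2 + B2", OF lip sec] nonneg AB tot
      by auto
  qed
  show "f \<in> classSK"
    using fH sense main main[of 1] by (simp add: f classSK_def hfun_def)
qed

theorem theorem3p9:
  shows "(\<forall>f1\<in>classU. \<forall>f2\<in>classU. hconv f1 f2 \<in> classU)
       \<and> (\<forall>f1\<in>classV. \<forall>f2\<in>classV. hconv f1 f2 \<in> classV)
       \<and> (\<forall>f1\<in>classU. \<forall>f2\<in>classU. hconv f1 f2 \<in> classSK)
       \<and> (\<forall>\<phi>\<in>classK. \<forall>f\<in>classU. tconv \<phi> f \<in> classU)
       \<and> (\<forall>\<phi>\<in>classK. \<forall>f\<in>classV. tconv \<phi> f \<in> classV)"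
proof -
  have "tconv \<phi> f \<in> classU" if "\<phi> \<in> classK" "f \<in> classU" for \<phi> f
    using that unfolding classU_eq by (intro tconv_classW) auto
  moreover have "tconv \<phi> f \<in> classV" if "\<phi> \<in> classK" "f \<in> classV" for \<phi> f
    using that unfolding classV_eq by (intro tconv_classW) auto
  ultimately show ?thesis
    \<comment> \<open>All three claims on \<open>hconv\<close> follow from U * U inside V, V inside
      U and V inside SK.\<close>
    using hconv_classU_classV classV_subset_classU classV_subset_classSK by blast
qed

end
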